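(* Let $0<p<1$ be a constant. Inserting the elements $1,2,\ldots,n$ in increasing order (or $n,n-1,\ldots,1$ in decreasing order) into an initially empty binary search tree, applying \textsc{RebalanceZig} after each insertion, results in a binary search tree in which every node has expected depth $O(\lg n)$.
   Context: Each new element is first placed as a new leaf $v$ at its standard unbalanced BST position, and then \textsc{RebalanceZig}$(v)$ is applied: while $v$ has a parent and an independent coin flip shows tail (tail has probability $p$, head probability $1-p$), set $v\gets$ parent of $v$; afterwards, if $v$ has a parent, rotate $v$ up (the standard single rotation at the parent of $v$ that moves $v$ one level up). The depth of a node is the number of edges from it to the root (the root has depth $0$). Expectation is over the coin flips. *)

theory Defs
  imports "HOL-Probability.Probability" "HOL-Library.Tree" "HOL-Library.Landau_Symbols"
begin

text \<open>
  A node of a tree is addressed by the list of directions leading to it from the root; the parent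
  of the node at a nonempty address \<open>v\<close> is at \<open>butlast v\<close>, and the root is at \<open>[]\<close>.
\<close>

datatype direction = Lft | Rgt

fun leaf_insert :: "'a::linorder \<Rightarrow> 'a tree \<Rightarrow> 'a tree" where
  "leaf_insert x Leaf = Node Leaf x Leaf"
| "leaf_insert x (Node l a r) =
     (if x < a then Node (leaf_insert x l) a r
      else if a < x then Node l a (leaf_insert x r)
      else Node l a r)"

fun address :: "'a::linorder \<Rightarrow> 'a tree \<Rightarrow> direction list" where
  "address x Leaf = []"
| "address x (Node l a r) =
     (if x < a then Lft # address x l
      else if a < x then Rgt # address x r
      else [])"

text \<open>Meaningful for keys that occur in a search tree.\<close>

definition depth :: "'a::linorder \<Rightarrow> 'a tree \<Rightarrow> nat" where
  "depth x t = length (address x t)"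

text \<open>
  Rotates the node at the given address above its parent. The last equation covers the root,
  which has no parent, and addresses at which there is no node.
\<close>

fun rotate_up :: "direction list \<Rightarrow> 'a tree \<Rightarrow> 'a tree" where
  "rotate_up [Lft] (Node (Node a x b) y c) = Node a x (Node b y c)"
| "rotate_up [Rgt] (Node a x (Node b y c)) = Node (Node a x b) y c"
| "rotate_up (Lft # d # ds) (Node l a r) = Node (rotate_up (d # ds) l) a r"
| "rotate_up (Rgt # d # ds) (Node l a r) = Node l a (rotate_up (d # ds) r)"
| "rotate_up _ t = t"

text \<open>The outcome \<open>True\<close> of a coin flip stands for tail, which has probability \<open>p\<close>.\<close>

function climb :: "real \<Rightarrow> direction list \<Rightarrow> direction list pmf" where
  "climb p v =
     (if v = [] then return_pmf []
      else bind_pmf (bernoulli_pmf p)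
             (\<lambda>tail. if tail then climb p (butlast v) else return_pmf v))"
  by auto
termination by (relation "Wellfounded.measure (\<lambda>(p, v). length v)") auto

declare climb.simps [simp del]

definition rebalance_zig :: "real \<Rightarrow> direction list \<Rightarrow> 'a tree \<Rightarrow> 'a tree pmf" where
  "rebalance_zig p v t = map_pmf (\<lambda>u. rotate_up u t) (climb p v)"

definition insert_zig :: "real \<Rightarrow> 'a::linorder \<Rightarrow> 'a tree \<Rightarrow> 'a tree pmf" where
  "insert_zig p x t = (let t' = leaf_insert x t in rebalance_zig p (address x t') t')"

definition zig_tree :: "real \<Rightarrow> 'a::linorder list \<Rightarrow> 'a tree pmf" where
  "zig_tree p xs = fold (\<lambda>x T. bind_pmf T (insert_zig p x)) xs (return_pmf Leaf)"

end

theory Submission imports Defs "HOL-Real_Asymp.Real_Asymp" begin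

text \<open>
  Consider increasing insertions. New keys enter at the end of the right spine, and a rotation on the
  spine removes one node from it, so the spine grows only if the climb reaches the root. With
  \<open>L\<close> nodes on the spine this has probability \<open>p ^ L\<close>, hence \<open>(1 / p) ^ L\<close> grows
  by \<open>1 / p - 1\<close> in expectation, and \<open>L\<close> is logarithmic by Jensen's inequality.
  For a key \<open>k\<close> let \<open>i\<close> be the number of right steps before the first left step on its
  path. A rotation at the spine node of depth \<open>j\<close> increases the depth of \<open>k\<close> only if
  \<open>j = i + 1\<close>, whereas \<open>j \<le> i\<close> decreases \<open>i - L\<close>. The ratio of the
  probabilities of these events makes \<open>depth k + (i - L) / p\<close> a supermartingale, which bounds
  the expected depth by a multiple of the expected spine length. Decreasing insertions are the
  mirror image.
\<close>

section \<open>Finitely supported expectations\<close>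

text \<open>Finite support makes every real function integrable, so even \<open>depth\<close> can be
  averaged one insertion at a time.\<close>

lemma expectation_bind_pmf_finite:
  fixes h :: "'b \<Rightarrow> real"
  assumes "finite (set_pmf T)" and "\<And>t. t \<in> set_pmf T \<Longrightarrow> finite (set_pmf (f t))"
  shows "measure_pmf.expectation (bind_pmf T f) h =
    measure_pmf.expectation T (\<lambda>t. measure_pmf.expectation (f t) h)"
  using assms
  by (simp add: pmf_expectation_bind[of "set_pmf T"] integral_measure_pmf[of "set_pmf T"])

lemma expectation_pmf_mono_finite:
  fixes f g :: "'a \<Rightarrow> real"
  assumes "finite (set_pmf T)" and "\<And>t. t \<in> set_pmf T \<Longrightarrow> f t \<le> g t"
  shows "measure_pmf.expectation T f \<le> measure_pmf.expectation T g"
  using assms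
  by (intro integral_mono_AE integrable_measure_pmf_finite) (auto simp: AE_measure_pmf_iff)

section \<open>Climbing\<close>

lemma set_pmf_climb: "set_pmf (climb p v) \<subseteq> (\<lambda>j. take j v) ` {..length v}"
proof (induction v rule: rev_induct)
  case Nil
  then show ?case by (simp add: climb.simps)
next
  case (snoc d v)
  have "set_pmf (climb p (v @ [d])) \<subseteq> insert (v @ [d]) (set_pmf (climb p v))"
    by (subst climb.simps) (auto split: if_splits)
  moreover have "(\<lambda>j. take j v) ` {..length v} \<subseteq> (\<lambda>j. take j (v @ [d])) ` {..length (v @ [d])}"
    by (force simp: image_iff)
  moreover have "v @ [d] \<in> (\<lambda>j. take j (v @ [d])) ` {..length (v @ [d])}"
    by (rule image_eqI[of _ _ "length (v @ [d])"]) auto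
  ultimately show ?case using snoc by blast
qed

lemma finite_set_pmf_climb [simp]: "finite (set_pmf (climb p v))"
  using set_pmf_climb finite_subset by blast

text \<open>Conditions on the first flip, which concerns the last direction; hence inductions over
  addresses run from the right.\<close>

lemma expectation_climb_snoc:
  fixes f :: "direction list \<Rightarrow> real"
  assumes "0 < p" "p < 1"
  shows "measure_pmf.expectation (climb p (v @ [d])) f =
    p * measure_pmf.expectation (climb p v) f + (1 - p) * f (v @ [d])"
  using assms by (subst climb.simps) (simp add: expectation_bind_pmf_finite)

lemma expectation_climb_Nil [simp]: "measure_pmf.expectation (climb p []) f = (f [] :: real)"
  by (simp add: climb.simps)

text \<open>The root is reached exactly when all \<open>length v\<close> flips show tail.\<close>

lemma expectation_climb_at_root:
  assumes "0 < p" "p < 1"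
  shows "measure_pmf.expectation (climb p v) (\<lambda>u. if u = [] then a else b) =
    b + p ^ length v * (a - b :: real)"
proof (induction v rule: rev_induct)
  case Nil
  then show ?case by simp
next
  case (snoc d v)
  then show ?case by (simp add: expectation_climb_snoc[OF assms]) (simp add: algebra_simps)
qed

text \<open>Bounds the change of \<open>potential\<close> for a key leaving the spine at depth
  \<open>i\<close> when the climb stops at depth \<open>j\<close>.\<close>

definition depth_drift :: "real \<Rightarrow> nat \<Rightarrow> nat \<Rightarrow> real" where
  "depth_drift p i j = (if j \<le> i then - 1 / p else if j = Suc i then 1 else 0)"

text \<open>Stops below depth \<open>i + 1\<close> contribute 0. A climb arriving at depth
  \<open>i + 1\<close> stops there with probability \<open>1 - p\<close> and otherwise collects
  \<open>- 1 / p\<close>, so it averages \<open>(1 - p) - 1 = - p\<close>.\<close>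

lemma expectation_climb_depth_drift:
  assumes "0 < p" "p < 1"
  shows "measure_pmf.expectation (climb p v) (\<lambda>u. depth_drift p i (length u)) \<le> 0"
proof -
  define E where "E v = measure_pmf.expectation (climb p v) (\<lambda>u. depth_drift p i (length u))" for v
  have E_snoc: "E (v @ [d]) = p * E v + (1 - p) * depth_drift p i (Suc (length v))" for v d
    using assms by (simp add: E_def expectation_climb_snoc)
  have low: "E v = - 1 / p" if "length v \<le> i" for v
    using that
  proof (induction v rule: rev_induct)
    case Nil
    then show ?case by (simp add: E_def depth_drift_def)
  next
    case (snoc d v)
    then show ?case using assms by (simp add: E_snoc depth_drift_def field_simps)
  qed
  have "E v \<le> 0"
  proof (induction v rule: rev_induct)
    case Nil
    then show ?case using low[of "[]"] assms by simp
  next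
    case (snoc d v)
    consider "length v < i" | "length v = i" | "length v > i" by linarith
    then show ?case
    proof cases
      case 1
      then show ?thesis using low[of "v @ [d]"] assms by simp
    next
      case 2
      then show ?thesis
        using low[of v] assms by (simp add: E_snoc depth_drift_def)
    next
      case 3
      then show ?thesis
        using snoc assms
        by (simp add: E_snoc depth_drift_def mult_nonneg_nonpos)
    qed
  qed
  then show ?thesis by (simp add: E_def)
qed

section \<open>Search trees\<close>

lemma set_tree_leaf_insert [simp]: "set_tree (leaf_insert x t) = insert x (set_tree t)"
  by (induction t) auto

lemma bst_leaf_insert: "bst t \<Longrightarrow> bst (leaf_insert x t)"
  by (induction t) auto

text \<open>The inorder sequence determines both the key set and the search tree property, so
  rotations preserve both.\<close>

lemma inorder_rotate_up [simp]: "inorder (rotate_up v t) = inorder t"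
  by (induction v t rule: rotate_up.induct) auto

lemma bst_rotate_up [simp]: "bst (rotate_up v t) \<longleftrightarrow> bst t"
  by (simp add: bst_iff_sorted_wrt_less)

lemma set_tree_rotate_up [simp]: "set_tree (rotate_up v t) = set_tree t"
  by (metis inorder_rotate_up set_inorder)

lemma zig_tree_Nil [simp]: "zig_tree p [] = return_pmf Leaf"
  by (simp add: zig_tree_def)

lemma zig_tree_snoc: "zig_tree p (xs @ [x]) = bind_pmf (zig_tree p xs) (insert_zig p x)"
  by (simp add: zig_tree_def)

lemma finite_set_pmf_insert_zig [simp]: "finite (set_pmf (insert_zig p x t))"
  by (simp add: insert_zig_def rebalance_zig_def Let_def)

lemma finite_set_pmf_zig_tree [simp]: "finite (set_pmf (zig_tree p xs))"
  by (induction xs rule: rev_induct) (auto simp: zig_tree_snoc)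

lemma bst_insert_zig:
  "u \<in> set_pmf (insert_zig p x t) \<Longrightarrow> bst t \<Longrightarrow> bst u \<and> set_tree u = insert x (set_tree t)"
  by (auto simp: insert_zig_def rebalance_zig_def Let_def bst_leaf_insert)

lemma bst_zig_tree: "t \<in> set_pmf (zig_tree p xs) \<Longrightarrow> bst t \<and> set_tree t = set xs"
proof (induction xs arbitrary: t rule: rev_induct)
  case Nil
  then show ?case by simp
next
  case (snoc x xs)
  then show ?case using bst_insert_zig by (fastforce simp: zig_tree_snoc)
qed

lemma expectation_zig_tree_snoc:
  "measure_pmf.expectation (zig_tree p (xs @ [x])) (h :: _ \<Rightarrow> real) =
    measure_pmf.expectation (zig_tree p xs) (\<lambda>t. measure_pmf.expectation (insert_zig p x t) h)"
  by (simp add: zig_tree_snoc expectation_bind_pmf_finite)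

section \<open>The right spine\<close>

fun spine_length :: "'a tree \<Rightarrow> nat" where
  "spine_length Leaf = 0"
| "spine_length (Node l a r) = Suc (spine_length r)"

text \<open>A spine node and all keys of its left subtree share one value, the depth of that spine
  node.\<close>

definition spine_pos :: "'a::linorder \<Rightarrow> 'a tree \<Rightarrow> nat" where
  "spine_pos x t = length (takeWhile ((=) Rgt) (address x t))"

lemma spine_pos_Node:
  "spine_pos k (Node l a r) = (if a < k then Suc (spine_pos k r) else 0)"
  by (auto simp: spine_pos_def)

lemma depth_Node:
  "depth k (Node l a r) =
    (if k < a then Suc (depth k l) else if a < k then Suc (depth k r) else 0)"
  by (auto simp: depth_def)

lemma spine_pos_less: "bst t \<Longrightarrow> k \<in> set_tree t \<Longrightarrow> spine_pos k t < spine_length t"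
  by (induction t) (auto simp: spine_pos_Node)

lemma address_leaf_insert_greater:
  "\<forall>y\<in>set_tree t. y < x \<Longrightarrow> address x (leaf_insert x t) = replicate (spine_length t) Rgt"
  by (induction t) auto

lemma spine_length_leaf_insert_greater:
  "\<forall>y\<in>set_tree t. y < x \<Longrightarrow> spine_length (leaf_insert x t) = Suc (spine_length t)"
  by (induction t) auto

lemma address_leaf_insert_other:
  "bst t \<Longrightarrow> k \<in> set_tree t \<Longrightarrow> address k (leaf_insert x t) = address k t"
  by (induction t) auto

lemma rotate_up_Cons_Rgt:
  "v \<noteq> [] \<Longrightarrow> rotate_up (Rgt # v) (Node l a r) = Node l a (rotate_up v r)"
  by (cases v) auto

lemma spine_length_greater_1E:
  assumes "Suc 0 < spine_length t"
  obtains l a m b r where "t = Node l a (Node m b r)"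
proof (cases t)
  case Leaf
  then show ?thesis using assms by simp
next
  case (Node l a r')
  then show ?thesis using assms that by (cases r') auto
qed

text \<open>The parent, at depth \<open>j\<close>, becomes the left child of the rotated node and so
  leaves the spine.\<close>

lemma spine_length_rotate_up:
  "Suc j < spine_length t \<Longrightarrow>
    Suc (spine_length (rotate_up (replicate (Suc j) Rgt) t)) = spine_length t"
proof (induction j arbitrary: t)
  case 0
  then show ?case by (auto elim!: spine_length_greater_1E)
next
  case (Suc j)
  then obtain l a r where "t = Node l a r" "Suc j < spine_length r" by (cases t) auto
  with Suc.IH[of r] show ?case
    by (subst replicate_Suc) (simp add: rotate_up_Cons_Rgt del: replicate_Suc)
qed

text \<open>The parent at depth \<open>j\<close> and its left subtree sink by one level. Keys
  further along the spine lose one right step; those in the left subtree of the rotated node keep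
  their depth, since their path gains a right step after its first left step.\<close>

lemma rotate_up_spine:
  assumes "bst t" "k \<in> set_tree t" "Suc j < spine_length t"
  defines "u \<equiv> rotate_up (replicate (Suc j) Rgt) t"
  shows "(Suc j \<le> spine_pos k t \<longrightarrow> Suc (spine_pos k u) = spine_pos k t \<and> depth k u \<le> depth k t) \<and>
    (j = spine_pos k t \<longrightarrow> spine_pos k u = spine_pos k t \<and> depth k u = Suc (depth k t)) \<and>
    (spine_pos k t < j \<longrightarrow> spine_pos k u = spine_pos k t \<and> depth k u = depth k t)"
  using assms(1-3) unfolding u_def
proof (induction j arbitrary: t)
  case 0
  then obtain l a m b r where "t = Node l a (Node m b r)"
    by (auto elim: spine_length_greater_1E)
  with 0 show ?case by (auto simp: spine_pos_Node depth_Node)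
next
  case (Suc j)
  then obtain l a r where t: "t = Node l a r" "Suc j < spine_length r" by (cases t) auto
  have u: "rotate_up (replicate (Suc (Suc j)) Rgt) t = Node l a (rotate_up (replicate (Suc j) Rgt) r)"
    by (subst replicate_Suc) (simp add: rotate_up_Cons_Rgt t del: replicate_Suc)
  show ?case
  proof (cases "a < k")
    case True
    then have "k \<in> set_tree r" using Suc.prems t by auto
    with Suc.IH[of r] Suc.prems t True show ?thesis
      unfolding u by (auto simp: spine_pos_Node depth_Node simp del: replicate_Suc)
  next
    case False
    then show ?thesis unfolding u by (auto simp: t spine_pos_Node depth_Node simp del: replicate_Suc)
  qed
qed

section \<open>Effect of inserting a new maximum\<close>

lemma expectation_insert_zig_greater:
  assumes "\<forall>y\<in>set_tree t. y < x"
  shows "measure_pmf.expectation (insert_zig p x t) (h :: _ \<Rightarrow> real) =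
    measure_pmf.expectation (climb p (replicate (spine_length t) Rgt))
      (\<lambda>v. h (rotate_up v (leaf_insert x t)))"
  using assms by (simp add: insert_zig_def rebalance_zig_def Let_def address_leaf_insert_greater)

lemma set_pmf_climb_replicate:
  assumes "v \<in> set_pmf (climb p (replicate n d))"
  obtains j where "j \<le> n" "v = replicate j d"
  using set_pmf_climb[of p "replicate n d"] assms by (auto simp: min_def split: if_splits)

text \<open>The new leaf lengthens the spine by one and a rotation undoes this; \<open>j = 0\<close>
  is the root, where nothing is rotated.\<close>

lemma spine_length_insert_max:
  assumes "\<forall>y\<in>set_tree t. y < x" and "j \<le> spine_length t"
  shows "spine_length (rotate_up (replicate j Rgt) (leaf_insert x t)) =
    (if j = 0 then Suc (spine_length t) else spine_length t)"
  using assms spine_length_rotate_up[of "j - 1" "leaf_insert x t"]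
  by (cases j) (auto simp: spine_length_leaf_insert_greater simp del: replicate_Suc)

definition potential :: "real \<Rightarrow> 'a::linorder \<Rightarrow> 'a tree \<Rightarrow> real" where
  "potential p k t = depth k t + (real (spine_pos k t) - real (spine_length t)) / p"

lemma potential_insert_max:
  assumes "bst t" "k \<in> set_tree t" "\<forall>y\<in>set_tree t. y < x" "j \<le> spine_length t" "0 < p"
  shows "potential p k (rotate_up (replicate j Rgt) (leaf_insert x t)) \<le>
    potential p k t + depth_drift p (spine_pos k t) j"
proof -
  let ?t = "leaf_insert x t"
  have t': "bst ?t" "k \<in> set_tree ?t" "spine_length ?t = Suc (spine_length t)"
    "spine_pos k ?t = spine_pos k t" "depth k ?t = depth k t"
    using assms by (simp_all add: bst_leaf_insert spine_length_leaf_insert_greater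
        spine_pos_def depth_def address_leaf_insert_other)
  show ?thesis
  proof (cases j)
    \<comment> \<open>Without a rotation only the spine length changes, so the potential drops by
      \<open>1 / p\<close>.\<close>
    case 0
    then show ?thesis using t' by (simp add: potential_def depth_drift_def diff_divide_distrib add_divide_distrib)
  next
    case (Suc i)
    have len: "spine_length (rotate_up (replicate j Rgt) ?t) = spine_length t"
      using spine_length_insert_max[OF assms(3,4)] Suc by simp
    have rot: "(j \<le> spine_pos k t \<longrightarrow> Suc (spine_pos k (rotate_up (replicate j Rgt) ?t)) = spine_pos k t
         \<and> depth k (rotate_up (replicate j Rgt) ?t) \<le> depth k t) \<and>
      (i = spine_pos k t \<longrightarrow> spine_pos k (rotate_up (replicate j Rgt) ?t) = spine_pos k t
         \<and> depth k (rotate_up (replicate j Rgt) ?t) = Suc (depth k t)) \<and>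
      (spine_pos k t < i \<longrightarrow> spine_pos k (rotate_up (replicate j Rgt) ?t) = spine_pos k t
         \<and> depth k (rotate_up (replicate j Rgt) ?t) = depth k t)"
      \<comment> \<open>The index \<open>i = j - 1\<close> is the depth of the parent of the rotated
        node.\<close>
      using rotate_up_spine[OF t'(1,2), of i] t' assms(4) Suc by (simp del: replicate_Suc)
    consider "j \<le> spine_pos k t" | "i = spine_pos k t" | "spine_pos k t < i"
      using Suc by linarith
    then show ?thesis
    proof cases
      case 1
      then have "real (spine_pos k t) = 1 + real (spine_pos k (rotate_up (replicate j Rgt) ?t))"
        "depth k (rotate_up (replicate j Rgt) ?t) \<le> depth k t"
        using rot by auto
      then show ?thesis
        using 1 len assms(5)
        by (simp add: potential_def depth_drift_def diff_divide_distrib add_divide_distrib)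
    next
      case 2
      then show ?thesis using rot len Suc by (simp add: potential_def depth_drift_def)
    next
      case 3
      then show ?thesis using rot len Suc by (simp add: potential_def depth_drift_def)
    qed
  qed
qed

lemma expectation_potential_insert_max:
  assumes "bst t" "k \<in> set_tree t" "\<forall>y\<in>set_tree t. y < x" "0 < p" "p < 1"
  shows "measure_pmf.expectation (insert_zig p x t) (potential p k) \<le> potential p k t"
proof -
  let ?C = "climb p (replicate (spine_length t) Rgt)"
  have "measure_pmf.expectation (insert_zig p x t) (potential p k) \<le>
      measure_pmf.expectation ?C (\<lambda>v. potential p k t + depth_drift p (spine_pos k t) (length v))"
    unfolding expectation_insert_zig_greater[OF assms(3)]
    using potential_insert_max[OF assms(1-3) _ assms(4)]
    by (intro expectation_pmf_mono_finite) (auto elim!: set_pmf_climb_replicate)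
  also have "\<dots> = potential p k t +
      measure_pmf.expectation ?C (\<lambda>v. depth_drift p (spine_pos k t) (length v))"
    by (subst Bochner_Integration.integral_add) (auto intro: integrable_measure_pmf_finite)
  also have "\<dots> \<le> potential p k t"
    using expectation_climb_depth_drift[OF assms(4,5)] by simp
  finally show ?thesis .
qed

text \<open>Starting value of the supermartingale: the new key enters at depth
  \<open>spine_length t\<close>, rotations on its own path do not lower it, and the correction term
  is negative.\<close>

lemma potential_insert_max_self:
  assumes "bst t" "\<forall>y\<in>set_tree t. y < x" "j \<le> spine_length t" "0 < p"
  shows "potential p x (rotate_up (replicate j Rgt) (leaf_insert x t)) \<le> spine_length t"
proof -
  let ?t = "leaf_insert x t" and ?u = "rotate_up (replicate j Rgt) (leaf_insert x t)"
  have t': "bst ?t" "x \<in> set_tree ?t" "spine_length ?t = Suc (spine_length t)"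
    "spine_pos x ?t = spine_length t" "depth x ?t = spine_length t"
    using assms by (simp_all add: bst_leaf_insert spine_length_leaf_insert_greater
        spine_pos_def depth_def address_leaf_insert_greater takeWhile_replicate)
  have "depth x ?u \<le> spine_length t"
    using rotate_up_spine[OF t'(1,2), of "j - 1"] t' assms(3)
    by (cases j) (auto simp del: replicate_Suc)
  moreover have "real (spine_pos x ?u) - real (spine_length ?u) \<le> 0"
    using spine_pos_less[of ?u x] t' by simp
  ultimately show ?thesis
    using divide_nonpos_pos[OF _ assms(4)] unfolding potential_def by (smt (verit) of_nat_mono)
qed

lemma expectation_potential_insert_max_self:
  assumes "bst t" "\<forall>y\<in>set_tree t. y < x" "0 < p"
  shows "measure_pmf.expectation (insert_zig p x t) (potential p x) \<le> spine_length t"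
proof -
  have "measure_pmf.expectation (insert_zig p x t) (potential p x) \<le>
      measure_pmf.expectation (climb p (replicate (spine_length t) Rgt)) (\<lambda>_. real (spine_length t))"
    unfolding expectation_insert_zig_greater[OF assms(2)]
    using potential_insert_max_self[OF assms(1,2) _ assms(3)]
    by (intro expectation_pmf_mono_finite) (auto elim!: set_pmf_climb_replicate)
  then show ?thesis by simp
qed

text \<open>No insertion of a maximum shortens the spine, so a bound from the time a key entered can
  be replaced by the final spine length.\<close>

lemma expectation_spine_length_insert_max:
  assumes "\<forall>y\<in>set_tree t. y < x"
  shows "spine_length t \<le> measure_pmf.expectation (insert_zig p x t) spine_length"
proof -
  have "measure_pmf.expectation (climb p (replicate (spine_length t) Rgt)) (\<lambda>_. real (spine_length t))
      \<le> measure_pmf.expectation (insert_zig p x t) spine_length"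
    unfolding expectation_insert_zig_greater[OF assms]
    using spine_length_insert_max[OF assms]
    by (intro expectation_pmf_mono_finite) (auto elim!: set_pmf_climb_replicate)
  then show ?thesis by simp
qed

text \<open>The power is multiplied by \<open>1 / p\<close> with probability \<open>p ^ L\<close>,
  where \<open>L\<close> is the old spine length; this probability cancels the power, leaving a gain
  independent of \<open>t\<close>.\<close>

lemma expectation_spine_power_insert_max:
  assumes "\<forall>y\<in>set_tree t. y < x" "0 < p" "p < 1"
  shows "measure_pmf.expectation (insert_zig p x t) (\<lambda>u. (1 / p) ^ spine_length u) =
    (1 / p) ^ spine_length t + (1 / p - 1)"
proof -
  let ?C = "climb p (replicate (spine_length t) Rgt)" and ?q = "(1 / p) ^ spine_length t"
  have "measure_pmf.expectation (insert_zig p x t) (\<lambda>u. (1 / p) ^ spine_length u) =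
      measure_pmf.expectation ?C (\<lambda>v. if v = [] then ?q / p else ?q)"
    unfolding expectation_insert_zig_greater[OF assms(1)]
    using spine_length_insert_max[OF assms(1)] spine_length_leaf_insert_greater[OF assms(1)]
    by (intro integral_cong_AE) (auto simp: AE_measure_pmf_iff elim!: set_pmf_climb_replicate)
  also have "\<dots> = ?q + p ^ spine_length t * (?q / p - ?q)"
    using expectation_climb_at_root[OF assms(2,3)] by simp
  also have "\<dots> = ?q + (1 / p - 1)"
    using assms(2) by (simp add: field_simps power_one_over)
  finally show ?thesis .
qed

section \<open>Increasing insertions\<close>

lemma zig_tree_sorted_less:
  assumes "sorted_wrt (<) (xs @ [x])" "t \<in> set_pmf (zig_tree p xs)"
  shows "bst t" "set_tree t = set xs" "\<forall>y\<in>set_tree t. y < x"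
  using bst_zig_tree[OF assms(2)] assms(1) by (auto simp: sorted_wrt_append)

lemma expectation_spine_power:
  assumes "sorted_wrt (<) xs" "0 < p" "p < 1"
  shows "measure_pmf.expectation (zig_tree p xs) (\<lambda>t. (1 / p) ^ spine_length t) =
    1 + real (length xs) * (1 / p - 1)"
  using assms(1)
proof (induction xs rule: rev_induct)
  case Nil
  then show ?case by simp
next
  case (snoc x xs)
  have "measure_pmf.expectation (zig_tree p (xs @ [x])) (\<lambda>t. (1 / p) ^ spine_length t) =
      measure_pmf.expectation (zig_tree p xs) (\<lambda>t. (1 / p) ^ spine_length t + (1 / p - 1))"
    unfolding expectation_zig_tree_snoc
    using zig_tree_sorted_less(3)[OF snoc.prems] assms(2,3)
    by (intro integral_cong_AE)
      (auto simp: AE_measure_pmf_iff intro!: expectation_spine_power_insert_max)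
  also have "\<dots> = 1 + real (length xs) * (1 / p - 1) + (1 / p - 1)"
    using snoc by (subst Bochner_Integration.integral_add)
      (auto intro: integrable_measure_pmf_finite simp: sorted_wrt_append)
  finally show ?case by (simp add: algebra_simps)
qed

lemma expectation_spine_length_le:
  assumes "sorted_wrt (<) xs" "0 < p" "p < 1"
  shows "measure_pmf.expectation (zig_tree p xs) spine_length \<le>
    ln (1 + real (length xs) * (1 / p - 1)) / ln (1 / p)"
proof -
  define a where "a = 1 + real (length xs) * (1 / p - 1)"
  have p: "1 / p > 1" using assms by simp
  then have a: "a > 0" unfolding a_def by (intro add_pos_nonneg) auto
  \<comment> \<open>Jensen's inequality through the tangent of \<open>ln\<close> at the mean \<open>a\<close>.\<close>
  have tangent: "real (spine_length t) * ln (1 / p) \<le> (1 / p) ^ spine_length t / a + (ln a - 1)"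
    for t :: "'a tree"
  proof -
    have "ln ((1 / p) ^ spine_length t / a) \<le> (1 / p) ^ spine_length t / a - 1"
      using a assms(2) by (intro ln_le_minus_one divide_pos_pos zero_less_power) auto
    then show ?thesis
      using a p assms(2) by (simp add: ln_div ln_realpow)
  qed
  have "measure_pmf.expectation (zig_tree p xs) spine_length * ln (1 / p) =
      measure_pmf.expectation (zig_tree p xs) (\<lambda>t. real (spine_length t) * ln (1 / p))"
    by simp
  also have "\<dots> \<le> measure_pmf.expectation (zig_tree p xs)
      (\<lambda>t. (1 / p) ^ spine_length t / a + (ln a - 1))"
    by (intro expectation_pmf_mono_finite tangent) simp
  also have "\<dots> = measure_pmf.expectation (zig_tree p xs) (\<lambda>t. (1 / p) ^ spine_length t) / a + (ln a - 1)"
    by (subst Bochner_Integration.integral_add) (auto intro: integrable_measure_pmf_finite)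
  \<comment> \<open>The mean of the power is exactly \<open>a\<close>, so the quotient is 1 and
    cancels the \<open>- 1\<close>.\<close>
  also have "\<dots> = ln a"
    using expectation_spine_power[OF assms] a by (simp add: a_def)
  finally show ?thesis
    using ln_gt_zero[OF p] by (simp add: a_def pos_le_divide_eq del: ln_gt_zero_iff)
qed

text \<open>When \<open>k\<close> enters, its expected potential is at most the expected spine
  length; afterwards the former does not grow and the latter does not shrink.\<close>

lemma expectation_potential_le:
  assumes "sorted_wrt (<) xs" "k \<in> set xs" "0 < p" "p < 1"
  shows "measure_pmf.expectation (zig_tree p xs) (potential p k) \<le>
    measure_pmf.expectation (zig_tree p xs) spine_length"
  using assms(1,2)
proof (induction xs rule: rev_induct)
  case Nil
  then show ?case by simp
next
  case (snoc x xs)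
  note less = zig_tree_sorted_less[OF snoc.prems(1)]
  have "measure_pmf.expectation (zig_tree p (xs @ [x])) (potential p k) \<le>
      measure_pmf.expectation (zig_tree p xs) spine_length"
  proof (cases "k \<in> set xs")
    case True
    have "measure_pmf.expectation (zig_tree p (xs @ [x])) (potential p k) \<le>
        measure_pmf.expectation (zig_tree p xs) (potential p k)"
      unfolding expectation_zig_tree_snoc
      using less True assms(3,4)
      by (intro expectation_pmf_mono_finite expectation_potential_insert_max) auto
    then show ?thesis using snoc True by (simp add: sorted_wrt_append)
  next
    case False
    then have "k = x" using snoc.prems by simp
    then show ?thesis
      unfolding expectation_zig_tree_snoc
      using less assms(3)
      by (auto intro!: expectation_pmf_mono_finite expectation_potential_insert_max_self)
  qed
  also have "\<dots> \<le> measure_pmf.expectation (zig_tree p (xs @ [x])) spine_length"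
    unfolding expectation_zig_tree_snoc
    using less by (intro expectation_pmf_mono_finite expectation_spine_length_insert_max) auto
  finally show ?case .
qed

lemma expectation_depth_le:
  assumes "sorted_wrt (<) xs" "k \<in> set xs" "0 < p" "p < 1"
  shows "measure_pmf.expectation (zig_tree p xs) (depth k) \<le>
    (1 + 1 / p) * (ln (1 + real (length xs) * (1 / p - 1)) / ln (1 / p))"
proof -
  let ?E = "measure_pmf.expectation (zig_tree p xs)"
  \<comment> \<open>Drops the nonnegative term \<open>spine_pos k t / p\<close>.\<close>
  have "?E (depth k) \<le> ?E (\<lambda>t. potential p k t + spine_length t / p)"
    using assms(3) by (intro expectation_pmf_mono_finite) (auto simp: potential_def field_simps)
  also have "\<dots> = ?E (potential p k) + ?E spine_length / p"
    by (subst Bochner_Integration.integral_add) (auto intro: integrable_measure_pmf_finite)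
  also have "\<dots> \<le> (1 + 1 / p) * ?E spine_length"
    using expectation_potential_le[OF assms] by (simp add: algebra_simps)
  also have "\<dots> \<le> (1 + 1 / p) * (ln (1 + real (length xs) * (1 / p - 1)) / ln (1 / p))"
    using assms(3) expectation_spine_length_le[OF assms(1,3,4)] by (intro mult_left_mono) auto
  finally show ?thesis .
qed

section \<open>Reflection\<close>

fun opposite :: "direction \<Rightarrow> direction" where
  "opposite Lft = Rgt"
| "opposite Rgt = Lft"

text \<open>With an order-reversing \<open>h\<close>, the mirror image is again a search tree. The
  key type may change because \<open>nat\<close> has no strictly decreasing self-map.\<close>

definition reflect :: "('a \<Rightarrow> 'b) \<Rightarrow> 'a tree \<Rightarrow> 'b tree" where
  "reflect h t = map_tree h (mirror t)"

lemma reflect_simps [simp]: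
  "reflect h Leaf = Leaf"
  "reflect h (Node l a r) = Node (reflect h r) (h a) (reflect h l)"
  by (simp_all add: reflect_def)

lemma leaf_insert_reflect:
  assumes "\<And>x y. h x < h y \<longleftrightarrow> y < x"
  shows "leaf_insert (h x) (reflect h t) = reflect h (leaf_insert x t)"
  by (induction t) (auto simp: assms)

lemma address_reflect:
  assumes "\<And>x y. h x < h y \<longleftrightarrow> y < x"
  shows "address (h x) (reflect h t) = map opposite (address x t)"
  by (induction t) (auto simp: assms)

lemma rotate_up_reflect: "rotate_up (map opposite v) (reflect h t) = reflect h (rotate_up v t)"
  by (induction v t rule: rotate_up.induct) auto

text \<open>The climb depends only on the length of the address, never on its directions.\<close>

lemma climb_map: "climb p (map f v) = map_pmf (map f) (climb p v)"
proof (induction v rule: rev_induct)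
  case Nil
  then show ?case by (simp add: climb.simps)
next
  case (snoc d v)
  then show ?case
    by (subst (1 2) climb.simps) (auto simp: map_bind_pmf intro!: bind_pmf_cong)
qed

lemma insert_zig_reflect:
  assumes "\<And>x y. h x < h y \<longleftrightarrow> y < x"
  shows "insert_zig p (h x) (reflect h t) = map_pmf (reflect h) (insert_zig p x t)"
  by (simp add: insert_zig_def rebalance_zig_def Let_def leaf_insert_reflect[of h, OF assms]
      address_reflect[of h, OF assms] climb_map pmf.map_comp o_def rotate_up_reflect)

lemma zig_tree_reflect:
  assumes "\<And>x y. h x < h y \<longleftrightarrow> y < x"
  shows "zig_tree p (map h xs) = map_pmf (reflect h) (zig_tree p xs)"
proof (induction xs rule: rev_induct)
  case Nil
  then show ?case by simp
next
  case (snoc x xs)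
  then show ?case
    by (simp add: zig_tree_snoc bind_map_pmf map_bind_pmf insert_zig_reflect[of h, OF assms])
qed

lemma expectation_depth_reflect:
  assumes "\<And>x y. h x < h y \<longleftrightarrow> y < x"
  shows "measure_pmf.expectation (zig_tree p (map h xs)) (\<lambda>t. real (depth (h k) t)) =
    measure_pmf.expectation (zig_tree p xs) (\<lambda>t. real (depth k t))"
  by (simp add: zig_tree_reflect[of h, OF assms] depth_def address_reflect[of h, OF assms])

section \<open>Logarithmic depth\<close>

lemma expectation_depth_monotone_order_le:
  assumes "0 < p" "p < 1" "k \<in> {1..n}"
    and "xs = [1..<Suc n] \<or> xs = rev [1..<Suc n]"
  shows "measure_pmf.expectation (zig_tree p xs) (\<lambda>t. real (depth k t)) \<le>
    (1 + 1 / p) * (ln (1 + real n * (1 / p - 1)) / ln (1 / p))"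
  using assms(4)
proof
  assume xs: "xs = [1..<Suc n]"
  show ?thesis
    using expectation_depth_le[of xs k p] assms(1-3) by (simp add: xs sorted_wrt_upt del: upt_Suc)
next
  assume xs: "xs = rev [1..<Suc n]"
  \<comment> \<open>Negation turns the decreasing order into an increasing list of integers, to
    which the bound for sorted lists applies.\<close>
  define h where "h = (\<lambda>i::nat. - int i)"
  have "sorted_wrt (<) (map h xs)"
    by (simp add: xs h_def sorted_wrt_map sorted_wrt_rev del: upt_Suc)
  moreover have "h k \<in> set (map h xs)" using assms(3) by (auto simp: xs simp del: upt_Suc)
  ultimately show ?thesis
    using expectation_depth_le[of "map h xs" "h k" p] assms(1,2) expectation_depth_reflect[of h p xs k]
    by (simp add: h_def xs del: upt_Suc)
qed

theorem theorem2:
  fixes p :: real and order :: "nat \<Rightarrow> nat list"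
  assumes "0 < p" and "p < 1"
    and "order = (\<lambda>n. [1..<Suc n]) \<or> order = (\<lambda>n. rev [1..<Suc n])"
  shows "(\<forall>n. \<forall>t \<in> set_pmf (zig_tree p (order n)). bst t \<and> set_tree t = {1..n}) \<and>
    (\<lambda>n. MAX k\<in>{1..n}. measure_pmf.expectation (zig_tree p (order n)) (\<lambda>t. real (depth k t)))
      \<in> O(\<lambda>n. log 2 (real n))"
proof
  have "set (order n) = {1..n}" for n using assms(3) by auto
  then show "\<forall>n. \<forall>t \<in> set_pmf (zig_tree p (order n)). bst t \<and> set_tree t = {1..n}"
    using bst_zig_tree by blast
next
  let ?M = "\<lambda>n. MAX k\<in>{1..n}. measure_pmf.expectation (zig_tree p (order n)) (\<lambda>t. real (depth k t))"
  let ?B = "\<lambda>n. (1 + 1 / p) * (ln (1 + real n * (1 / p - 1)) / ln (1 / p))"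
  have order: "order n = [1..<Suc n] \<or> order n = rev [1..<Suc n]" for n
    using assms(3) by auto
  \<comment> \<open>For \<open>n = 0\<close> the maximum would range over the empty set.\<close>
  have "norm (?M n) \<le> norm (?B n)" if "n \<ge> 1" for n
  proof -
    have "?M n \<in> (\<lambda>k. measure_pmf.expectation (zig_tree p (order n)) (\<lambda>t. real (depth k t))) ` {1..n}"
      using that by (intro Max_in) auto
    then obtain k where k: "k \<in> {1..n}"
      "?M n = measure_pmf.expectation (zig_tree p (order n)) (\<lambda>t. real (depth k t))" by blast
    have "0 \<le> ?M n" unfolding k(2) by (rule integral_nonneg_AE) simp
    moreover have "?M n \<le> ?B n"
      unfolding k(2) by (rule expectation_depth_monotone_order_le[OF assms(1,2) k(1) order])
    ultimately show ?thesis by (simp only: real_norm_def abs_of_nonneg order_trans)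
  qed
  then have "?M \<in> O(?B)"
    by (intro landau_o.big_mono eventually_at_top_linorderI[of 1]) blast
  also have "?B \<in> O(\<lambda>n. log 2 (real n))"
  proof -
    \<comment> \<open>Besides constant factors, \<open>p\<close> enters the bound only through this
      slope, positive because \<open>p < 1\<close>; so the logarithm grows like
      \<open>ln n\<close>.\<close>
    define c where "c = 1 / p - 1"
    have "c > 0" using assms(1,2) by (simp add: c_def)
    then have "(\<lambda>n. ln (1 + real n * c)) \<in> O(\<lambda>n. log 2 (real n))" by real_asymp
    then show ?thesis using assms(1,2) by (simp add: c_def)
  qed
  finally show "?M \<in> O(\<lambda>n. log 2 (real n))" .
qed

end
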